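(* Let $g>0$, $\omega\ne0$, and let $p_\pm,l,m,\rho_0$ be as in the context. For all sufficiently large $|\xi|$ the following holds. Let $\lambda>0$ be a growth rate with rotation, i.e. $\lambda$ satisfies $$-\lambda^2=\inf_{(\varphi,\psi)\in\mathcal{A}}\frac12\int_{-m}^l\Big\{p'(\rho_0)\rho_0(\psi'+|\xi|\varphi)^2-2g|\xi|\rho_0\psi\varphi+\frac{4\omega^2}{\lambda^2}\rho_0\varphi^2\Big\}dx_3,$$ and let $\lambda_0>0$ be the growth rate without rotation, i.e. $$-\lambda_0^2=\inf_{(\varphi,\psi)\in\mathcal{A}}\frac12\int_{-m}^l\big\{p'(\rho_0)\rho_0(\psi'+|\xi|\varphi)^2-2g|\xi|\rho_0\psi\varphi\big\}dx_3.$$ Then $\lambda<\lambda_0$.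
   Context: Setting. $p_\pm\in C^\infty(0,\infty)$ are nonnegative, strictly increasing pressure laws with $1/p_\pm'\in L^\infty_{\rm loc}(0,\infty)$, and $\{z\in(0,\infty): p_-(z)>p_+(z),\ p_-(z)\in p_+(0,\infty)\}\ne\emptyset$. The constants $l,m>0$ and the function $\rho_0=\rho_0(x_3)$ on $(-m,l)$ satisfy: $\rho_0$ is bounded above and below by positive constants, is smooth on each of $(-m,0)$ and $(0,l)$, solves $\frac{d}{dx_3}p_+(\rho_0)=-g\rho_0$ on $(0,l)$ and $\frac{d}{dx_3}p_-(\rho_0)=-g\rho_0$ on $(-m,0)$, with $p_+(\rho_0^+)=p_-(\rho_0^-)$ at $x_3=0$, and $\rho_0(0^+)-\rho_0(0^-)>0$. $p'(\rho_0)$ means $p_+'(\rho_0)$ on $(0,l)$ and $p_-'(\rho_0)$ on $(-m,0)$; $'=d/dx_3$ on $\psi$. $\mathcal{A}=\{(\varphi,\psi)\in L^2(-m,l)\times H_0^1(-m,l):\frac12\int_{-m}^l\rho_0(\varphi^2+\psi^2)dx_3=1\}$. *)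

theory Defs
  imports "HOL-Analysis.Analysis"
begin

text \<open>Membership in \<open>C\<^sup>\<infinity>(S)\<close>, to be used for open \<open>S\<close> only.\<close>
definition smooth_on_open :: "real set \<Rightarrow> (real \<Rightarrow> real) \<Rightarrow> bool" where
  "smooth_on_open S f \<longleftrightarrow> (\<forall>k::nat. \<forall>x\<in>S. (deriv ^^ k) f differentiable (at x))"

definition Linf_loc :: "real set \<Rightarrow> (real \<Rightarrow> real) \<Rightarrow> bool" where
  "Linf_loc S f \<longleftrightarrow> set_borel_measurable lebesgue S f \<and>
     (\<forall>K. compact K \<and> K \<subseteq> S \<longrightarrow> (\<exists>C. AE x in lebesgue. x \<in> K \<longrightarrow> \<bar>f x\<bar> \<le> C))"

text \<open>Since \<open>1 / 0 = 0\<close> here, the well-definedness of \<open>1 / p'\<close> almost everywhere is a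
  separate conjunct.\<close>
definition pressure_law :: "(real \<Rightarrow> real) \<Rightarrow> bool" where
  "pressure_law p \<longleftrightarrow>
     smooth_on_open {0<..} p \<and>
     (\<forall>z>0. 0 \<le> p z) \<and>
     strict_mono_on {0<..} p \<and>
     (AE z in lebesgue. 0 < z \<longrightarrow> deriv p z \<noteq> 0) \<and>
     Linf_loc {0<..} (\<lambda>z. 1 / deriv p z)"

text \<open>The density is discontinuous at the interface \<open>x = 0\<close>, so its value there is left
  unconstrained.\<close>
definition steady_density ::
  "real \<Rightarrow> (real \<Rightarrow> real) \<Rightarrow> (real \<Rightarrow> real) \<Rightarrow> real \<Rightarrow> real \<Rightarrow> (real \<Rightarrow> real) \<Rightarrow> bool" where
  "steady_density g p_plus p_minus l m \<rho>0 \<longleftrightarrow>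
     (\<exists>a>0. \<exists>b>0. \<forall>x\<in>{-m<..<l} - {0}. a \<le> \<rho>0 x \<and> \<rho>0 x \<le> b) \<and>
     smooth_on_open {-m<..<0} \<rho>0 \<and>
     smooth_on_open {0<..<l} \<rho>0 \<and>
     (\<forall>x\<in>{0<..<l}. ((\<lambda>y. p_plus (\<rho>0 y)) has_real_derivative - g * \<rho>0 x) (at x)) \<and>
     (\<forall>x\<in>{-m<..<0}. ((\<lambda>y. p_minus (\<rho>0 y)) has_real_derivative - g * \<rho>0 x) (at x)) \<and>
     (\<exists>r_plus r_minus. (\<rho>0 \<longlongrightarrow> r_plus) (at_right 0) \<and> (\<rho>0 \<longlongrightarrow> r_minus) (at_left 0) \<and>
        p_plus r_plus = p_minus r_minus \<and> r_plus - r_minus > 0)"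

definition dpressure ::
  "(real \<Rightarrow> real) \<Rightarrow> (real \<Rightarrow> real) \<Rightarrow> (real \<Rightarrow> real) \<Rightarrow> real \<Rightarrow> real" where
  "dpressure p_plus p_minus \<rho>0 x =
     (if 0 < x then deriv p_plus (\<rho>0 x) else deriv p_minus (\<rho>0 x))"

definition L2 :: "real set \<Rightarrow> (real \<Rightarrow> real) set" where
  "L2 S = {f. set_borel_measurable lebesgue S f \<and> set_integrable lebesgue S (\<lambda>x. (f x)\<^sup>2)}"

definition test_fun :: "real \<Rightarrow> real \<Rightarrow> (real \<Rightarrow> real) \<Rightarrow> bool" where
  "test_fun a b \<eta> \<longleftrightarrow> smooth_on_open UNIV \<eta> \<and>
     (\<exists>K. compact K \<and> K \<subseteq> {a<..<b} \<and> (\<forall>x. x \<notin> K \<longrightarrow> \<eta> x = 0))"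

definition is_weak_deriv :: "real \<Rightarrow> real \<Rightarrow> (real \<Rightarrow> real) \<Rightarrow> (real \<Rightarrow> real) \<Rightarrow> bool" where
  "is_weak_deriv a b f d \<longleftrightarrow> f \<in> L2 {a<..<b} \<and> d \<in> L2 {a<..<b} \<and>
     (\<forall>\<eta>. test_fun a b \<eta> \<longrightarrow>
        (LINT x:{a<..<b}|lebesgue. f x * deriv \<eta> x) = - (LINT x:{a<..<b}|lebesgue. d x * \<eta> x))"

text \<open>A representative of the weak derivative, which is unique up to null sets.\<close>
definition weak_deriv :: "real \<Rightarrow> real \<Rightarrow> (real \<Rightarrow> real) \<Rightarrow> real \<Rightarrow> real" where
  "weak_deriv a b f = (SOME d. is_weak_deriv a b f d)"

text \<open>The closure of the test functions in the \<open>H\<^sup>1\<close> norm.\<close>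
definition H10 :: "real \<Rightarrow> real \<Rightarrow> (real \<Rightarrow> real) set" where
  "H10 a b = {f. \<exists>d. is_weak_deriv a b f d \<and>
     (\<exists>\<eta>::nat \<Rightarrow> real \<Rightarrow> real. (\<forall>n. test_fun a b (\<eta> n)) \<and>
        (\<lambda>n. LINT x:{a<..<b}|lebesgue. (\<eta> n x - f x)\<^sup>2 + (deriv (\<eta> n) x - d x)\<^sup>2) \<longlonglongrightarrow> 0)}"

definition admissible ::
  "real \<Rightarrow> real \<Rightarrow> (real \<Rightarrow> real) \<Rightarrow> ((real \<Rightarrow> real) \<times> (real \<Rightarrow> real)) set" where
  "admissible l m \<rho>0 = {(\<phi>, \<psi>). \<phi> \<in> L2 {-m<..<l} \<and> \<psi> \<in> H10 (-m) l \<and>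
     1/2 * (LINT x:{-m<..<l}|lebesgue. \<rho>0 x * ((\<phi> x)\<^sup>2 + (\<psi> x)\<^sup>2)) = 1}"

end

theory Submission
  imports Defs
begin

text \<open>
  Let \<open>E\<close> and \<open>E\<^sub>0\<close> be the energies with and without rotation, so that
  \<open>E = E\<^sub>0 + (c / 2) N\<close> with \<open>c = 4 \<omega>\<^sup>2 / \<lambda>\<^sup>2\<close> and \<open>N = \<integral> \<rho>\<^sub>0 \<phi>\<^sup>2\<close>. Since the only negative term of
  \<open>E\<^sub>0\<close> is bilinear in \<open>\<phi>\<close> and \<open>\<psi>\<close>, a small \<open>N\<close> forces the energy to be almost nonnegative; so \<open>N\<close>
  stays away from \<open>0\<close> where \<open>E\<close> is close to its negative infimum, and there \<open>E\<close> exceeds \<open>E\<^sub>0\<close> by a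
  definite amount. No minimizer is needed.
\<close>

section \<open>Measurability and integrability of weighted products\<close>

text \<open>The interval splits into two open pieces, where continuity gives measurability, and the
  point \<open>0\<close>, which contributes a multiple of the indicator of a singleton. This covers
  coefficients that jump at the interface, whatever their value there.\<close>

lemma set_borel_measurable_lebesgue_punctured:
  fixes f :: "real \<Rightarrow> real"
  assumes "l > 0" "m > 0" "continuous_on {-m<..<0} f" "continuous_on {0<..<l} f"
  shows "set_borel_measurable lebesgue {-m<..<l} f"
proof -
  have piece: "(\<lambda>x. indicat_real T x * f x) \<in> borel_measurable lebesgue"
    if "open T" "continuous_on T f" for T
    using borel_measurable_continuous_on_indicator[of T f] that
    by (auto intro!: measurable_completion simp: mult.commute)
  have "(\<lambda>x. indicat_real {-m<..<l} x * f x) =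
    (\<lambda>x. indicat_real {-m<..<0} x * f x + indicat_real {0<..<l} x * f x + indicat_real {0} x * f 0)"
    using assms(1,2) by (auto simp: fun_eq_iff indicator_def)
  moreover have "(\<lambda>x. indicat_real {0} x * f 0) \<in> borel_measurable lebesgue"
    by (intro measurable_completion) auto
  ultimately show ?thesis
    unfolding set_borel_measurable_def real_scaleR_def
    by (simp only:) (intro borel_measurable_add piece assms(3,4) open_greaterThanLessThan)
qed

lemma set_borel_measurable_mult:
  fixes f h :: "'a \<Rightarrow> real"
  assumes "set_borel_measurable M A f" "set_borel_measurable M A h"
  shows "set_borel_measurable M A (\<lambda>x. f x * h x)"
proof -
  have "(\<lambda>x. indicat_real A x *\<^sub>R (f x * h x)) =
    (\<lambda>x. (indicat_real A x *\<^sub>R f x) * (indicat_real A x *\<^sub>R h x))"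
    by (auto simp: indicator_def)
  with assms show ?thesis by (simp add: set_borel_measurable_def)
qed

text \<open>The product is dominated by \<open>C * (f\<^sup>2 + h\<^sup>2)\<close>. Each term of the
  energy has this form, with a bounded weight built from the density and the pressure
  derivative.\<close>

lemma L2_weighted_mult_integrable:
  assumes f: "f \<in> L2 A" and h: "h \<in> L2 A" and w: "set_borel_measurable lebesgue A w"
    and C: "\<And>x. x \<in> A \<Longrightarrow> \<bar>w x\<bar> \<le> C"
  shows "set_integrable lebesgue A (\<lambda>x. w x * (f x * h x))"
proof -
  have i: "set_integrable lebesgue A (\<lambda>x. C * ((f x)\<^sup>2 + (h x)\<^sup>2))"
    using f h by (auto simp: L2_def intro!: set_integral_add)
  have m: "set_borel_measurable lebesgue A (\<lambda>x. w x * (f x * h x))"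
    using f h w by (auto simp: L2_def intro!: set_borel_measurable_mult)
  have le: "\<bar>w x * (f x * h x)\<bar> \<le> \<bar>C * ((f x)\<^sup>2 + (h x)\<^sup>2)\<bar>" if "x \<in> A" for x
  proof -
    have "\<bar>f x * h x\<bar> \<le> (f x)\<^sup>2 + (h x)\<^sup>2"
      using sum_squares_bound[of "\<bar>f x\<bar>" "\<bar>h x\<bar>"]
        mult_nonneg_nonneg[OF abs_ge_zero[of "f x"] abs_ge_zero[of "h x"]]
      unfolding abs_mult power2_abs by linarith
    then have "\<bar>w x * (f x * h x)\<bar> \<le> C * ((f x)\<^sup>2 + (h x)\<^sup>2)"
      unfolding abs_mult[of "w x"] using C[OF that] by (intro mult_mono) auto
    then show ?thesis by linarith
  qed
  show ?thesis
    by (rule set_integrable_bound[OF i m]) (unfold real_norm_def, intro AE_I2 impI le)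
qed

text \<open>Domination by \<open>2 f\<^sup>2 + 2 c\<^sup>2 h\<^sup>2\<close>; meant for the
  combination \<open>\<psi>' + k * \<phi>\<close> in the compression term.\<close>

lemma L2_add_scaled:
  assumes f: "f \<in> L2 A" and h: "h \<in> L2 A"
  shows "(\<lambda>x. f x + c * h x) \<in> L2 A"
proof -
  have m: "set_borel_measurable lebesgue A (\<lambda>x. f x + c * h x)"
    using f h by (auto simp: L2_def set_borel_measurable_def algebra_simps)
  have i: "set_integrable lebesgue A (\<lambda>x. 2 * (f x)\<^sup>2 + (2 * c\<^sup>2) * (h x)\<^sup>2)"
    using f h by (auto simp: L2_def intro!: set_integral_add)
  have m2: "set_borel_measurable lebesgue A (\<lambda>x. (f x + c * h x)\<^sup>2)"
    unfolding power2_eq_square by (intro set_borel_measurable_mult m)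
  have le: "(f x + c * h x)\<^sup>2 \<le> \<bar>2 * (f x)\<^sup>2 + (2 * c\<^sup>2) * (h x)\<^sup>2\<bar>" for x
  proof -
    have "0 \<le> (f x - c * h x)\<^sup>2" by simp
    then have "(f x + c * h x)\<^sup>2 \<le> 2 * (f x)\<^sup>2 + (2 * c\<^sup>2) * (h x)\<^sup>2"
      by (simp add: power2_eq_square algebra_simps)
    then show ?thesis by linarith
  qed
  have "set_integrable lebesgue A (\<lambda>x. (f x + c * h x)\<^sup>2)"
    by (rule set_integrable_bound[OF i m2]) (unfold real_norm_def abs_power2, intro AE_I2 impI le)
  with m show ?thesis by (simp add: L2_def)
qed

section \<open>Regularity, sign and bounds of the coefficients\<close>

lemma pressure_law_continuous_deriv:
  assumes "pressure_law p"
  shows "continuous_on {0<..} (deriv p)"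
proof (intro continuous_at_imp_continuous_on ballI)
  fix z :: real assume "z \<in> {0<..}"
  then have "(deriv ^^ 1) p differentiable (at z)"
    using assms unfolding pressure_law_def smooth_on_open_def by blast
  then show "isCont (deriv p) z"
    by (auto intro: differentiable_imp_continuous_within)
qed

lemma pressure_law_deriv_nonneg:
  assumes "pressure_law p" "z > 0"
  shows "deriv p z \<ge> 0"
proof (rule mono_on_imp_deriv_nonneg)
  show "mono_on {0<..} p"
    using assms by (auto simp: pressure_law_def strict_mono_on_imp_mono_on)
  have "(deriv ^^ 0) p differentiable (at z)"
    using assms unfolding pressure_law_def smooth_on_open_def by (meson greaterThan_iff)
  then show "(p has_real_derivative deriv p z) (at z)"
    by (simp add: DERIV_deriv_iff_real_differentiable)
  show "z \<in> interior {0<..}" using assms by (simp add: interior_open)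
qed

text \<open>Compactness; \<open>a > 0\<close> keeps \<open>{a..b}\<close> inside the domain where
  the derivative is continuous.\<close>

lemma pressure_law_deriv_bounded:
  assumes "pressure_law p" "a > 0"
  obtains C where "\<And>z. z \<in> {a..b} \<Longrightarrow> \<bar>deriv p z\<bar> \<le> C"
proof -
  have "continuous_on {a..b} (deriv p)"
    using pressure_law_continuous_deriv[OF assms(1)] by (rule continuous_on_subset) (use assms in auto)
  then have "bounded (deriv p ` {a..b})"
    by (intro compact_imp_bounded compact_continuous_image) auto
  then obtain C where "\<forall>z\<in>{a..b}. \<bar>deriv p z\<bar> \<le> C"
    by (auto simp: bounded_iff)
  then show ?thesis using that by blast
qed

lemma steady_density_bounds:
  assumes "steady_density g p_plus p_minus l m \<rho>0"
  obtains a b where "a > 0" "\<And>x. x \<in> {-m<..<l} - {0} \<Longrightarrow> a \<le> \<rho>0 x \<and> \<rho>0 x \<le> b"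
  using assms unfolding steady_density_def by blast

lemma steady_density_continuous:
  assumes "steady_density g p_plus p_minus l m \<rho>0"
  shows "continuous_on {-m<..<0} \<rho>0" "continuous_on {0<..<l} \<rho>0"
proof -
  have "continuous_on S \<rho>0" if "smooth_on_open S \<rho>0" for S
  proof (intro continuous_at_imp_continuous_on ballI)
    fix x assume "x \<in> S"
    with that have "(deriv ^^ 0) \<rho>0 differentiable (at x)"
      unfolding smooth_on_open_def by blast
    then show "isCont \<rho>0 x"
      by (auto intro: differentiable_imp_continuous_within)
  qed
  then show "continuous_on {-m<..<0} \<rho>0" "continuous_on {0<..<l} \<rho>0"
    using assms by (auto simp: steady_density_def)
qed

lemma steady_density_bounded_measurable:
  assumes "l > 0" "m > 0" and st: "steady_density g p_plus p_minus l m \<rho>0"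
  obtains C where "set_borel_measurable lebesgue {-m<..<l} \<rho>0"
    "\<And>x. x \<in> {-m<..<l} \<Longrightarrow> \<bar>\<rho>0 x\<bar> \<le> C"
proof -
  obtain a b where ab: "a > 0" "\<And>x. x \<in> {-m<..<l} - {0} \<Longrightarrow> a \<le> \<rho>0 x \<and> \<rho>0 x \<le> b"
    by (rule steady_density_bounds[OF st]) blast
  \<comment> \<open>The value at the interface is arbitrary, so it is joined to the bound to make
    the bound hold at every point.\<close>
  have "\<bar>\<rho>0 x\<bar> \<le> max b \<bar>\<rho>0 0\<bar>" if "x \<in> {-m<..<l}" for x
    using ab(1) ab(2)[of x] that by (cases "x = 0") auto
  then show ?thesis
    using that set_borel_measurable_lebesgue_punctured[OF assms(1,2) steady_density_continuous[OF st]]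
    by blast
qed

text \<open>On each side of the interface the density has values in a compact interval of positive
  numbers, on which the pressure derivatives are continuous and bounded. The sign is claimed only
  off \<open>0\<close>, since the density at \<open>0\<close> may fail to be positive.\<close>

lemma dpressure_bounded_measurable:
  assumes "l > 0" "m > 0" and st: "steady_density g p_plus p_minus l m \<rho>0"
    and pp: "pressure_law p_plus" and pm: "pressure_law p_minus"
  obtains C where
    "set_borel_measurable lebesgue {-m<..<l} (dpressure p_plus p_minus \<rho>0)"
    "\<And>x. x \<in> {-m<..<l} \<Longrightarrow> \<bar>dpressure p_plus p_minus \<rho>0 x\<bar> \<le> C"
    "\<And>x. x \<in> {-m<..<l} - {0} \<Longrightarrow> dpressure p_plus p_minus \<rho>0 x \<ge> 0"
proof -
  let ?q = "dpressure p_plus p_minus \<rho>0"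
  obtain a b where ab: "a > 0" "\<And>x. x \<in> {-m<..<l} - {0} \<Longrightarrow> a \<le> \<rho>0 x \<and> \<rho>0 x \<le> b"
    by (rule steady_density_bounds[OF st]) blast
  note r = steady_density_continuous[OF st]
  have pos: "\<rho>0 x > 0" if "x \<in> {-m<..<l} - {0}" for x
    using ab(1) ab(2)[OF that] by linarith
  have "continuous_on {-m<..<0} (\<lambda>x. deriv p_minus (\<rho>0 x))"
    by (rule continuous_on_compose2[OF pressure_law_continuous_deriv[OF pm] r(1)])
       (use assms(1) in \<open>auto intro!: pos\<close>)
  then have c1: "continuous_on {-m<..<0} ?q"
    by (rule continuous_on_eq) (auto simp: dpressure_def)
  have "continuous_on {0<..<l} (\<lambda>x. deriv p_plus (\<rho>0 x))"
    by (rule continuous_on_compose2[OF pressure_law_continuous_deriv[OF pp] r(2)])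
       (use assms(2) in \<open>auto intro!: pos\<close>)
  then have c2: "continuous_on {0<..<l} ?q"
    by (rule continuous_on_eq) (auto simp: dpressure_def)
  obtain C1 where C1: "\<And>z. z \<in> {a..b} \<Longrightarrow> \<bar>deriv p_plus z\<bar> \<le> C1"
    using pressure_law_deriv_bounded[OF pp ab(1)] by blast
  obtain C2 where C2: "\<And>z. z \<in> {a..b} \<Longrightarrow> \<bar>deriv p_minus z\<bar> \<le> C2"
    using pressure_law_deriv_bounded[OF pm ab(1)] by blast
  have "\<bar>?q x\<bar> \<le> max (max C1 C2) \<bar>?q 0\<bar>" if "x \<in> {-m<..<l}" for x
  proof (cases "x = 0")
    case False
    with that ab(2)[of x] have "\<rho>0 x \<in> {a..b}" by auto
    from C1[OF this] C2[OF this] show ?thesis by (auto simp: dpressure_def)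
  qed simp
  moreover have "?q x \<ge> 0" if "x \<in> {-m<..<l} - {0}" for x
    using pressure_law_deriv_nonneg[OF pp pos[OF that]] pressure_law_deriv_nonneg[OF pm pos[OF that]]
    by (simp add: dpressure_def)
  ultimately show ?thesis
    using that set_borel_measurable_lebesgue_punctured[OF assms(1,2) c1 c2] by blast
qed

section \<open>Existence of an admissible pair\<close>

lemma const_L2: "(\<lambda>x. c) \<in> L2 {a<..<b}"
proof -
  have "(\<lambda>x. indicat_real {a<..<b} x * c) \<in> borel_measurable lebesgue" for c
    by (intro measurable_completion) auto
  moreover have "emeasure lborel {a<..<b} < top"
    by (cases "a \<le> b") auto
  ultimately show ?thesis
    by (auto simp: L2_def set_borel_measurable_def set_integrable_def)
qed

lemma zero_H10: "(\<lambda>x. 0) \<in> H10 a b"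
proof -
  have z: "(deriv ^^ k) (\<lambda>x::real. 0::real) = (\<lambda>x. 0)" for k
    by (induction k) auto
  have "test_fun a b (\<lambda>x. 0)"
    by (auto simp: test_fun_def smooth_on_open_def z intro: exI[of _ "{}"])
  moreover have "is_weak_deriv a b (\<lambda>x. 0) (\<lambda>x. 0)"
    by (simp add: is_weak_deriv_def const_L2)
  ultimately show ?thesis
    unfolding H10_def by (auto intro!: exI[of _ "\<lambda>x. 0"] exI[of _ "\<lambda>n x. 0"])
qed

text \<open>A constant \<open>\<phi>\<close> paired with \<open>\<psi> = 0\<close> can be
  normalized, because the total mass is positive. Nonemptiness lets a uniform lower bound on the
  energy pass to its infimum.\<close>

lemma admissible_nonempty:
  assumes "l > 0" "m > 0" and st: "steady_density g p_plus p_minus l m \<rho>0"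
  shows "admissible l m \<rho>0 \<noteq> {}"
proof -
  let ?S = "{-m<..<l}"
  obtain a b where ab: "a > 0" "\<And>x. x \<in> ?S - {0} \<Longrightarrow> a \<le> \<rho>0 x \<and> \<rho>0 x \<le> b"
    by (rule steady_density_bounds[OF st]) blast
  obtain C where C: "set_borel_measurable lebesgue ?S \<rho>0" "\<And>x. x \<in> ?S \<Longrightarrow> \<bar>\<rho>0 x\<bar> \<le> C"
    by (rule steady_density_bounded_measurable[OF assms]) blast
  have i: "set_integrable lebesgue ?S \<rho>0"
    using L2_weighted_mult_integrable[OF const_L2[of 1] const_L2[of 1] C] by simp
  \<comment> \<open>The constant \<open>a\<close> is the square of \<open>sqrt a\<close>, so its
    integrability is part of \<open>const_L2\<close>.\<close>
  have ia: "set_integrable lebesgue ?S (\<lambda>x. a)"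
    using const_L2[of "sqrt a" "-m" l] ab(1) by (simp add: L2_def)
  define I where "I = (LINT x:?S|lebesgue. \<rho>0 x)"
  have ae: "AE x in lebesgue. x \<noteq> (0::real)"
    by (rule AE_completion[OF AE_lborel_singleton])
  have "(LINT x:?S|lebesgue. a) \<le> I"
    unfolding I_def by (rule set_integral_mono_AE[OF ia i]) (use ae ab(2) in \<open>auto elim!: eventually_mono\<close>)
  moreover have "(LINT x:?S|lebesgue. a) = a * (l + m)"
    using assms(1,2) by (simp add: set_lebesgue_integral_def)
  ultimately have I: "I > 0"
    using ab(1) assms(1,2) mult_pos_pos[of a "l + m"] by linarith
  \<comment> \<open>The constant \<open>sqrt (2 / I)\<close> makes the integral \<open>2\<close>,
    which matches the factor \<open>1/2\<close> in the constraint.\<close>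
  have "(LINT x:?S|lebesgue. \<rho>0 x * ((sqrt (2 / I))\<^sup>2 + 0\<^sup>2)) = 2"
    using I by (simp add: I_def[symmetric])
  then have "(\<lambda>x. sqrt (2 / I), \<lambda>x. 0) \<in> admissible l m \<rho>0"
    by (simp add: admissible_def const_L2 zero_H10)
  then show ?thesis by blast
qed

section \<open>Lower bounds and splitting of the energy\<close>

text \<open>The second bound is Cauchy's inequality with a small parameter: the buoyancy term is
  controlled by the kinetic energy of \<open>\<psi>\<close> with arbitrarily small weight, at the cost of a large
  multiple of that of \<open>\<phi>\<close>.\<close>
lemma energy_bounds:
  fixes k g \<epsilon> :: real
  assumes "l > 0" "m > 0" "g > 0" "k \<ge> 0" "\<epsilon> > 0"
    and st: "steady_density g p_plus p_minus l m \<rho>0"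
    and pp: "pressure_law p_plus" and pm: "pressure_law p_minus"
    and adm: "(\<phi>, \<psi>) \<in> admissible l m \<rho>0"
  defines "N \<equiv> (LINT x:{-m<..<l}|lebesgue. \<rho>0 x * (\<phi> x)\<^sup>2)"
    and "E0 \<equiv> 1/2 * (LINT x:{-m<..<l}|lebesgue.
          dpressure p_plus p_minus \<rho>0 x * \<rho>0 x * (weak_deriv (-m) l \<psi> x + k * \<phi> x)\<^sup>2
          - 2 * g * k * \<rho>0 x * \<psi> x * \<phi> x)"
  shows "N \<ge> 0" and "N \<le> 2"
    and "E0 \<ge> - (g * k * \<epsilon>) - g * k / (2 * \<epsilon>) * N"
    and "1/2 * (LINT x:{-m<..<l}|lebesgue.
          dpressure p_plus p_minus \<rho>0 x * \<rho>0 x * (weak_deriv (-m) l \<psi> x + k * \<phi> x)\<^sup>2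
          - 2 * g * k * \<rho>0 x * \<psi> x * \<phi> x
          + c * \<rho>0 x * (\<phi> x)\<^sup>2) = E0 + c / 2 * N"
proof -
  let ?S = "{-m<..<l}" and ?q = "dpressure p_plus p_minus \<rho>0"
  let ?d = "weak_deriv (-m) l \<psi>"
  obtain a b where ab: "a > 0" "\<And>x. x \<in> ?S - {0} \<Longrightarrow> a \<le> \<rho>0 x \<and> \<rho>0 x \<le> b"
    by (rule steady_density_bounds[OF st]) blast
  have pos: "\<rho>0 x \<ge> 0" if "x \<in> ?S" "x \<noteq> 0" for x
    using ab(1) ab(2)[of x] that by auto
  obtain C where C: "set_borel_measurable lebesgue ?S \<rho>0" "\<And>x. x \<in> ?S \<Longrightarrow> \<bar>\<rho>0 x\<bar> \<le> C"
    by (rule steady_density_bounded_measurable[OF assms(1,2) st]) blast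
  obtain D where D: "set_borel_measurable lebesgue ?S ?q" "\<And>x. x \<in> ?S \<Longrightarrow> \<bar>?q x\<bar> \<le> D"
    "\<And>x. x \<in> ?S - {0} \<Longrightarrow> ?q x \<ge> 0"
    by (rule dpressure_bounded_measurable[OF assms(1,2) st pp pm]) blast
  have \<phi>: "\<phi> \<in> L2 ?S" and H: "\<psi> \<in> H10 (-m) l"
    and norm: "(LINT x:?S|lebesgue. \<rho>0 x * ((\<phi> x)\<^sup>2 + (\<psi> x)\<^sup>2)) = 2"
    using adm by (auto simp: admissible_def)
  \<comment> \<open>Membership in \<open>H10\<close> supplies a weak derivative, so the
    representative picked by \<open>SOME\<close> is one too and lies in \<open>L2\<close>.\<close>
  have "\<exists>d. is_weak_deriv (-m) l \<psi> d"
    using H by (auto simp: H10_def)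
  then have "is_weak_deriv (-m) l \<psi> ?d"
    unfolding weak_deriv_def by (rule someI_ex)
  then have \<psi>: "\<psi> \<in> L2 ?S" and d: "?d \<in> L2 ?S"
    by (auto simp: is_weak_deriv_def)
  have qb: "\<bar>?q x * \<rho>0 x\<bar> \<le> D * C" if "x \<in> ?S" for x
    unfolding abs_mult using C(2)[OF that] D(2)[OF that] by (intro mult_mono) auto
  note L = L2_add_scaled[OF d \<phi>, of k]
  have i1: "set_integrable lebesgue ?S (\<lambda>x. ?q x * \<rho>0 x * (?d x + k * \<phi> x)\<^sup>2)"
    using L2_weighted_mult_integrable[OF L L set_borel_measurable_mult[OF D(1) C(1)] qb]
    by (simp add: power2_eq_square)
  have i2: "set_integrable lebesgue ?S (\<lambda>x. 2 * g * k * \<rho>0 x * \<psi> x * \<phi> x)"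
    using set_integrable_mult_right[OF L2_weighted_mult_integrable[OF \<psi> \<phi> C], of "2 * g * k"]
    by (simp add: mult.assoc)
  have i3: "set_integrable lebesgue ?S (\<lambda>x. \<rho>0 x * (\<phi> x)\<^sup>2)"
    using L2_weighted_mult_integrable[OF \<phi> \<phi> C] by (simp add: power2_eq_square)
  have i4: "set_integrable lebesgue ?S (\<lambda>x. \<rho>0 x * (\<psi> x)\<^sup>2)"
    using L2_weighted_mult_integrable[OF \<psi> \<psi> C] by (simp add: power2_eq_square)
  have i12: "set_integrable lebesgue ?S (\<lambda>x. ?q x * \<rho>0 x * (?d x + k * \<phi> x)\<^sup>2 - 2 * g * k * \<rho>0 x * \<psi> x * \<phi> x)"
    using i1 i2 by (rule set_integral_diff)
  have ic: "set_integrable lebesgue ?S (\<lambda>x. c * (\<rho>0 x * (\<phi> x)\<^sup>2))" for c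
    using i3 by (intro set_integrable_mult_right)
  have id: "set_integrable lebesgue ?S (\<lambda>x. c * (\<rho>0 x * (\<psi> x)\<^sup>2))" for c
    using i4 by (intro set_integrable_mult_right)
  \<comment> \<open>The signs of the coefficients are known only off the interface, which is a null
    set.\<close>
  have ae: "AE x in lebesgue. x \<noteq> (0::real)"
    by (rule AE_completion[OF AE_lborel_singleton])
  show N: "N \<ge> 0"
    unfolding N_def set_lebesgue_integral_def
    by (rule integral_nonneg_AE) (use ae pos in \<open>auto elim!: eventually_mono simp: indicator_def\<close>)
  have \<psi>0: "0 \<le> (LINT x:?S|lebesgue. \<rho>0 x * (\<psi> x)\<^sup>2)"
    unfolding set_lebesgue_integral_def
    by (rule integral_nonneg_AE) (use ae pos in \<open>auto elim!: eventually_mono simp: indicator_def\<close>)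
  have "(LINT x:?S|lebesgue. \<rho>0 x * (\<phi> x)\<^sup>2 + \<rho>0 x * (\<psi> x)\<^sup>2) = N + (LINT x:?S|lebesgue. \<rho>0 x * (\<psi> x)\<^sup>2)"
    unfolding N_def by (rule set_integral_add(2)[OF i3 i4])
  then have sum: "N + (LINT x:?S|lebesgue. \<rho>0 x * (\<psi> x)\<^sup>2) = 2"
    using norm by (simp add: distrib_left)
  with \<psi>0 show "N \<le> 2" by simp
  have \<psi>N: "(LINT x:?S|lebesgue. \<rho>0 x * (\<psi> x)\<^sup>2) \<le> 2"
    using sum N by simp
  have "(LINT x:?S|lebesgue. (- (g * k * \<epsilon>)) * (\<rho>0 x * (\<psi> x)\<^sup>2) + (- (g * k / \<epsilon>)) * (\<rho>0 x * (\<phi> x)\<^sup>2))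
    \<le> (LINT x:?S|lebesgue. ?q x * \<rho>0 x * (?d x + k * \<phi> x)\<^sup>2 - 2 * g * k * \<rho>0 x * \<psi> x * \<phi> x)"
  proof (rule set_integral_mono_AE[OF set_integral_add(1)[OF id ic] i12])
    have "(- (g * k * \<epsilon>)) * (\<rho>0 x * (\<psi> x)\<^sup>2) + (- (g * k / \<epsilon>)) * (\<rho>0 x * (\<phi> x)\<^sup>2)
      \<le> ?q x * \<rho>0 x * (?d x + k * \<phi> x)\<^sup>2 - 2 * g * k * \<rho>0 x * \<psi> x * \<phi> x"
      if "x \<in> ?S" "x \<noteq> 0" for x
    proof -
      \<comment> \<open>Expanding this square bounds the buoyancy term; the division by
        \<open>\<epsilon>\<close> puts the small weight on \<open>\<psi>\<close> and the large one
        on \<open>\<phi>\<close>.\<close>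
      have "0 \<le> g * k * \<rho>0 x * (\<epsilon> * \<psi> x - \<phi> x)\<^sup>2 / \<epsilon>"
        using assms pos[OF that] by (intro divide_nonneg_pos mult_nonneg_nonneg) auto
      also have "\<dots> = g * k * \<epsilon> * (\<rho>0 x * (\<psi> x)\<^sup>2) + g * k / \<epsilon> * (\<rho>0 x * (\<phi> x)\<^sup>2) - 2 * g * k * \<rho>0 x * \<psi> x * \<phi> x"
        using \<open>\<epsilon> > 0\<close> by (simp add: field_simps power2_eq_square)
      finally have "2 * g * k * \<rho>0 x * \<psi> x * \<phi> x \<le> g * k * \<epsilon> * (\<rho>0 x * (\<psi> x)\<^sup>2) + g * k / \<epsilon> * (\<rho>0 x * (\<phi> x)\<^sup>2)"
        by simp
      moreover have "0 \<le> ?q x * \<rho>0 x * (?d x + k * \<phi> x)\<^sup>2"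
        using pos[OF that] D(3)[of x] that by simp
      ultimately show ?thesis by simp
    qed
    with ae show "AE x\<in>?S in lebesgue. (- (g * k * \<epsilon>)) * (\<rho>0 x * (\<psi> x)\<^sup>2) + (- (g * k / \<epsilon>)) * (\<rho>0 x * (\<phi> x)\<^sup>2)
      \<le> ?q x * \<rho>0 x * (?d x + k * \<phi> x)\<^sup>2 - 2 * g * k * \<rho>0 x * \<psi> x * \<phi> x"
      by (auto elim!: eventually_mono)
  qed
  also have "(LINT x:?S|lebesgue. (- (g * k * \<epsilon>)) * (\<rho>0 x * (\<psi> x)\<^sup>2) + (- (g * k / \<epsilon>)) * (\<rho>0 x * (\<phi> x)\<^sup>2))
    = - (g * k * \<epsilon>) * (LINT x:?S|lebesgue. \<rho>0 x * (\<psi> x)\<^sup>2) - g * k / \<epsilon> * N"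
    unfolding N_def set_integral_add(2)[OF id ic] set_integral_mult_right by simp
  finally have "- (g * k * \<epsilon>) * (LINT x:?S|lebesgue. \<rho>0 x * (\<psi> x)\<^sup>2) - g * k / \<epsilon> * N \<le> 2 * E0"
    by (simp add: E0_def)
  moreover have "g * k * \<epsilon> * (LINT x:?S|lebesgue. \<rho>0 x * (\<psi> x)\<^sup>2) \<le> g * k * \<epsilon> * 2"
    using \<psi>N assms by (intro mult_left_mono) auto
  moreover have "g * k / (2 * \<epsilon>) * N = (g * k / \<epsilon> * N) / 2"
    by simp
  \<comment> \<open>To be read with \<open>u = g * k * \<epsilon>\<close>, \<open>v\<close> the
    weighted integral of the square of \<open>\<psi>\<close>,
    \<open>y = g * k / \<epsilon> * N\<close>, \<open>z = y / 2\<close> and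
    \<open>e = E0\<close>.\<close>
  moreover have "- u - z \<le> e" if "- u * v - y \<le> 2 * e" "u * v \<le> u * 2" "z = y / 2" for u v y z e :: real
    using that by simp
  ultimately show "E0 \<ge> - (g * k * \<epsilon>) - g * k / (2 * \<epsilon>) * N"
    by blast
  show "1/2 * (LINT x:?S|lebesgue.
          ?q x * \<rho>0 x * (?d x + k * \<phi> x)\<^sup>2
          - 2 * g * k * \<rho>0 x * \<psi> x * \<phi> x
          + c * \<rho>0 x * (\<phi> x)\<^sup>2) = E0 + c / 2 * N"
    using set_integral_add(2)[OF i12 ic[of c]]
    by (simp add: E0_def N_def mult.assoc distrib_left)
qed

section \<open>Comparison of the two infima\<close>

theorem mainTheorem4:
  fixes g \<omega> l m :: real
    and p_plus p_minus \<rho>0 :: "real \<Rightarrow> real"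
  assumes "g > 0" and "\<omega> \<noteq> 0" and "l > 0" and "m > 0"
    and "pressure_law p_plus" and "pressure_law p_minus"
    and "{z \<in> {0<..}. p_minus z > p_plus z \<and> p_minus z \<in> p_plus ` {0<..}} \<noteq> {}"
    and "steady_density g p_plus p_minus l m \<rho>0"
  shows "\<exists>R. \<forall>\<xi>::real^2. norm \<xi> \<ge> R \<longrightarrow>
    (\<forall>rate rate0 :: real.
      rate > 0 \<and>
      - rate\<^sup>2 = (INF (\<phi>, \<psi>) \<in> admissible l m \<rho>0.
        1/2 * (LINT x:{-m<..<l}|lebesgue.
          dpressure p_plus p_minus \<rho>0 x * \<rho>0 x * (weak_deriv (-m) l \<psi> x + norm \<xi> * \<phi> x)\<^sup>2
          - 2 * g * norm \<xi> * \<rho>0 x * \<psi> x * \<phi> x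
          + 4 * \<omega>\<^sup>2 / rate\<^sup>2 * \<rho>0 x * (\<phi> x)\<^sup>2)) \<and>
      rate0 > 0 \<and>
      - rate0\<^sup>2 = (INF (\<phi>, \<psi>) \<in> admissible l m \<rho>0.
        1/2 * (LINT x:{-m<..<l}|lebesgue.
          dpressure p_plus p_minus \<rho>0 x * \<rho>0 x * (weak_deriv (-m) l \<psi> x + norm \<xi> * \<phi> x)\<^sup>2
          - 2 * g * norm \<xi> * \<rho>0 x * \<psi> x * \<phi> x))
      \<longrightarrow> rate < rate0)"
proof (intro exI[of _ 0] allI impI, elim conjE)
  fix \<xi> :: "real^2" and rate rate0 :: real
  define k where "k = norm \<xi>"
  define c where "c = 4 * \<omega>\<^sup>2 / rate\<^sup>2"
  define E0 where "E0 = (\<lambda>(\<phi>, \<psi>). 1/2 * (LINT x:{-m<..<l}|lebesgue.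
          dpressure p_plus p_minus \<rho>0 x * \<rho>0 x * (weak_deriv (-m) l \<psi> x + k * \<phi> x)\<^sup>2
          - 2 * g * k * \<rho>0 x * \<psi> x * \<phi> x))"
  define E where "E = (\<lambda>(\<phi>, \<psi>). 1/2 * (LINT x:{-m<..<l}|lebesgue.
          dpressure p_plus p_minus \<rho>0 x * \<rho>0 x * (weak_deriv (-m) l \<psi> x + k * \<phi> x)\<^sup>2
          - 2 * g * k * \<rho>0 x * \<psi> x * \<phi> x
          + c * \<rho>0 x * (\<phi> x)\<^sup>2))"
  define N where "N = (\<lambda>(\<phi>, \<psi> :: real \<Rightarrow> real). (LINT x:{-m<..<l}|lebesgue. \<rho>0 x * (\<phi> x)\<^sup>2))"
  let ?A = "admissible l m \<rho>0"
  assume rate: "rate > 0" and rate0: "rate0 > 0"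
    and "- rate\<^sup>2 = (INF (\<phi>, \<psi>) \<in> admissible l m \<rho>0.
        1/2 * (LINT x:{-m<..<l}|lebesgue.
          dpressure p_plus p_minus \<rho>0 x * \<rho>0 x * (weak_deriv (-m) l \<psi> x + norm \<xi> * \<phi> x)\<^sup>2
          - 2 * g * norm \<xi> * \<rho>0 x * \<psi> x * \<phi> x
          + 4 * \<omega>\<^sup>2 / rate\<^sup>2 * \<rho>0 x * (\<phi> x)\<^sup>2))"
    and "- rate0\<^sup>2 = (INF (\<phi>, \<psi>) \<in> admissible l m \<rho>0.
        1/2 * (LINT x:{-m<..<l}|lebesgue.
          dpressure p_plus p_minus \<rho>0 x * \<rho>0 x * (weak_deriv (-m) l \<psi> x + norm \<xi> * \<phi> x)\<^sup>2
          - 2 * g * norm \<xi> * \<rho>0 x * \<psi> x * \<phi> x))"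
  then have inf: "- rate\<^sup>2 = Inf (E ` ?A)" and inf0: "- rate0\<^sup>2 = Inf (E0 ` ?A)"
    by (simp_all only: E_def E0_def k_def c_def)
  have k: "k \<ge> 0" and c: "c > 0" using rate assms(2) by (auto simp: k_def c_def)
  have bnd: "N u \<ge> 0" "N u \<le> 2" "E u = E0 u + c / 2 * N u"
    "\<epsilon> > 0 \<Longrightarrow> E0 u \<ge> - (g * k * \<epsilon>) - g * k / (2 * \<epsilon>) * N u" if "u \<in> ?A" for u \<epsilon>
  proof -
    obtain \<phi> \<psi> where u: "u = (\<phi>, \<psi>)" by (cases u)
    note L = energy_bounds[OF assms(3,4,1) k _ assms(8,5,6) that[unfolded u]]
    show "N u \<ge> 0" "N u \<le> 2" "E u = E0 u + c / 2 * N u"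
      \<comment> \<open>These three facts do not involve \<open>\<epsilon>\<close>, so the value
        \<open>1\<close> may be taken in its place.\<close>
      using L(1-2,4)[OF zero_less_one] by (simp_all add: u E_def E0_def N_def)
    show "E0 u \<ge> - (g * k * \<epsilon>) - g * k / (2 * \<epsilon>) * N u" if "\<epsilon> > 0"
      using L(3)[OF that] by (simp add: u E0_def N_def)
  qed
  show "rate < rate0"
  proof (rule ccontr)
    assume "\<not> rate < rate0"
    then have le: "rate0\<^sup>2 \<le> rate\<^sup>2" using rate0 by (intro power_mono) auto
    \<comment> \<open>Chosen so that \<open>g * k * \<epsilon>\<close> is at most half the depth
      \<open>rate\<^sup>2\<close> of the infimum; the \<open>+ 1\<close> keeps the denominator
      positive when \<open>k = 0\<close>.\<close>
    define \<epsilon> where "\<epsilon> = rate\<^sup>2 / (2 * (g * k + 1))"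
    define B where "B = g * k / (2 * \<epsilon>)"
    have gk: "g * k \<ge> 0" using assms(1) k by simp
    have \<epsilon>: "\<epsilon> > 0" using rate gk by (simp add: \<epsilon>_def)
    have B: "B \<ge> 0" using gk \<epsilon> by (simp add: B_def)
    have small: "g * k * \<epsilon> \<le> rate\<^sup>2 / 2"
      using gk by (simp add: \<epsilon>_def field_simps)
    have E0_ge: "- rate0\<^sup>2 \<le> E0 u" if "u \<in> ?A" for u
      unfolding inf0
    proof (rule cINF_lower[OF _ that])
      \<comment> \<open>A real \<open>Inf\<close> is a lower bound only for a set bounded below.
        Here \<open>\<epsilon> = 1\<close> and \<open>N \<le> 2\<close> give the bound
        \<open>- 2 g k\<close>.\<close>
      show "bdd_below (E0 ` ?A)"
      proof (rule bdd_belowI2)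
        fix v assume v: "v \<in> ?A"
        have "g * k / (2 * 1) * N v \<le> g * k / (2 * 1) * 2"
          using gk bnd(2)[OF v] by (intro mult_left_mono) auto
        then show "- (2 * (g * k)) \<le> E0 v"
          using bnd(4)[OF v, of 1] by simp
      qed
    qed
    text \<open>If \<open>rate0 \<le> rate\<close>, then \<open>E \<ge> - rate\<^sup>2 + c / 2 * N\<close> and \<open>E \<ge> - rate\<^sup>2 / 2 - B * N\<close>;
      in the combination with weights \<open>B\<close> and \<open>c / 2\<close> the terms with \<open>N\<close> cancel.\<close>
    define L where "L = - (B + c / 4) / (B + c / 2) * rate\<^sup>2"
    have "L \<le> E u" if "u \<in> ?A" for u
    proof -
      have "B * (- rate\<^sup>2 + c / 2 * N u) \<le> B * E u"
        using B bnd(3)[OF that] E0_ge[OF that] le by (intro mult_left_mono) auto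
      moreover have "c / 2 * (- (rate\<^sup>2 / 2) - B * N u) \<le> c / 2 * E u"
      proof (rule mult_left_mono)
        \<comment> \<open>The rotation term is nonnegative, so the lower bound for \<open>E0\<close>
          carries over to \<open>E\<close>.\<close>
        have "c / 2 * N u \<ge> 0" using c bnd(1)[OF that] by simp
        then show "- (rate\<^sup>2 / 2) - B * N u \<le> E u"
          using bnd(3)[OF that] bnd(4)[OF that \<epsilon>] small unfolding B_def by linarith
      qed (use c in simp)
      ultimately have "- (B + c / 4) * rate\<^sup>2 \<le> (B + c / 2) * E u"
        by (simp add: algebra_simps)
      then show ?thesis using B c by (simp add: L_def field_simps)
    qed
    then have "L \<le> - rate\<^sup>2"
      unfolding inf by (intro cINF_greatest admissible_nonempty[OF assms(3,4,8)]) auto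
    \<comment> \<open>The factor \<open>(B + c / 4) / (B + c / 2)\<close> is less than
      \<open>1\<close> exactly because \<open>c > 0\<close>: this is where
      \<open>\<omega> \<noteq> 0\<close> makes the inequality strict.\<close>
    moreover have "L > - rate\<^sup>2"
      using B c rate by (simp add: L_def field_simps)
    ultimately show False by simp
  qed
qed

end
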